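(* Assume $p<d<n$. For the weighted least squares model with weight matrix $\mathbf W$ and design matrix $\mathbf X_p$ (the weights $\mathbf W$ being used both for model fitting and for model evaluation), the classical model degrees of freedom $\mathrm{df}_{\rm F}(p)$ increases in $p$, and $$\Delta\mathrm{df}_{\rm F}(p):=\mathrm{df}_{\rm F}(p+1)-\mathrm{df}_{\rm F}(p)=\frac{\|\tilde{\mathbf r}_{(p+1)}\|_{\mathbf U}^2}{\|\tilde{\mathbf r}_{(p+1)}\|^2},\qquad\text{where }\ \mathbf U=\frac{1}{\bar w}\mathbf W^{1/2}\mathbf T\mathbf W^{1/2}.$$
   Context: Setting: $\mathbf X\in\mathbb R^{n\times d}$ is a design matrix of full column rank with rows $\mathbf x_1^\top,\dots,\mathbf x_n^\top$ and columns $\mathbf x_{(1)},\dots,\mathbf x_{(d)}\in\mathbb R^n$ (one column per variable). The responses $\mathbf y\in\mathbb R^n$ satisfy $\mathrm{Var}(\mathbf y\mid\mathbf X)=\sigma_\varepsilon^2\mathbf T$ with $\sigma_\varepsilon^2>0$ and $\mathbf T=\mathrm{diag}(\tau_1,\dots,\tau_n)$, $\tau_i=\tau(\mathbf x_i)>0$. A positive weight function $w$ gives $w_i=w(\mathbf x_i)>0$, $\mathbf W=\mathrm{diag}(w_1,\dots,w_n)$, $\bar w=\frac1n\sum_{i=1}^n w_i$. Subset regression: variables enter along a nested sequence of subsets $\mathcal S_1\subset\cdots\subset\mathcal S_d=\{1,\dots,d\}$ with $|\mathcal S_p|=p$; variables are labelled in order of entry, so $\mathbf X_p=(\mathbf x_{(1)},\dots,\mathbf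 x_{(p)})$ and $\mathbf X_{p+1}=(\mathbf X_p,\mathbf x_{(p+1)})$. The weighted least squares model of size $p$ minimizes $(\mathbf y-\mathbf X_p\mathbf b)^\top\mathbf W(\mathbf y-\mathbf X_p\mathbf b)$ over $\mathbf b\in\mathbb R^p$; its hat matrix is $\mathbf H=\mathbf X_p(\mathbf X_p^\top\mathbf W\mathbf X_p)^{-1}\mathbf X_p^\top\mathbf W$. Its classical model degrees of freedom is $$\mathrm{df}_{\rm F}(p)=\frac1{\bar w}\mathrm{tr}(\mathbf H\mathbf T\mathbf W)=\frac1{\bar w}\mathrm{tr}\big[(\mathbf X_p^\top\mathbf W\mathbf X_p)^{-1}\mathbf X_p^\top\mathbf W\mathbf T\mathbf W\mathbf X_p\big].$$ Notation: $\tilde{\mathbf X}_p=\mathbf W^{1/2}\mathbf X_p/\sqrt{\bar w}$, $\tilde{\mathbf x}_{(p+1)}=\mathbf W^{1/2}\mathbf x_{(p+1)}/\sqrt{\bar w}$, $\tilde{\mathbf H}=\tilde{\mathbf X}_p(\tilde{\mathbf X}_p^\top\tilde{\mathbf X}_p)^{-1}\tilde{\mathbf X}_p^\top$, $\tilde{\mathbf r}_{(p+1)}=(\mathbf I_n-\tilde{\mathbf H})\tilde{\mathbf x}_{(p+1)}$. $\|\cdot\|$ is the Euclidean norm and $\|\mathbf a\|_{\mathbf U}^2=\mathbf a^\top\mathbf U\mathbf a$. *)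

theory Defs
  imports
    "HOL-Probability.Probability"
    "Jordan_Normal_Form.Gauss_Jordan_Elimination"
    "Jordan_Normal_Form.DL_Rank"
begin

text \<open>
  The number of columns of the submatrix used in the regression varies inside the
  statement, so matrices and vectors are those of Jordan_Normal_Form (dimensions
  are terms, indices start at 0), not those of HOL-Analysis. Fully qualified names
  are used where the two libraries clash.

  The design is fixed: the probability measure carrying the responses stands for
  their conditional law given the design.
\<close>

definition mat_trace :: "real Matrix.mat \<Rightarrow> real" where
  "mat_trace A = (\<Sum>i<dim_row A. A $$ (i, i))"

text \<open>
  The library inverse is option-valued; the value is the genuine inverse of every
  invertible square matrix and unspecified otherwise.
\<close>

definition mat_inv :: "real Matrix.mat \<Rightarrow> real Matrix.mat" where
  "mat_inv A = the (mat_inverse A)"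

definition euclid_norm :: "real Matrix.vec \<Rightarrow> real" where
  "euclid_norm a = sqrt (a \<bullet> a)"

text \<open>The squared \<open>U\<close>-norm of \<open>a\<close>.\<close>

definition sq_norm_wrt :: "real Matrix.mat \<Rightarrow> real Matrix.vec \<Rightarrow> real" where
  "sq_norm_wrt U a = a \<bullet> (U *\<^sub>v a)"

text \<open>
  The responses are random variables \<open>y 0, \<dots>, y (n - 1)\<close>; square integrability
  makes the entries of the covariance matrix \<open>S\<close> meaningful.
\<close>

definition has_covariance_mat ::
  "'a measure \<Rightarrow> nat \<Rightarrow> (nat \<Rightarrow> 'a \<Rightarrow> real) \<Rightarrow> real Matrix.mat \<Rightarrow> bool" where
  "has_covariance_mat M n y S \<longleftrightarrow>
     S \<in> carrier_mat n n \<and>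
     (\<forall>i<n. y i \<in> borel_measurable M \<and> integrable M (\<lambda>\<omega>. (y i \<omega>)\<^sup>2)) \<and>
     (\<forall>i<n. \<forall>j<n. S $$ (i, j) =
        (LINT \<omega>|M. (y i \<omega> - (LINT \<nu>|M. y i \<nu>)) * (y j \<omega> - (LINT \<nu>|M. y j \<nu>))))"

text \<open>
  The diagonal matrix of the values of \<open>f\<close> at the rows of \<open>X\<close>: it is \<open>W\<close> for
  \<open>f = w\<close>, \<open>T\<close> for \<open>f = \<tau>\<close>, and the square root of \<open>W\<close> for \<open>f = sqrt \<circ> w\<close>.
\<close>

definition row_diag :: "real Matrix.mat \<Rightarrow> (real Matrix.vec \<Rightarrow> real) \<Rightarrow> real Matrix.mat" where
  "row_diag X f = mat_diag (dim_row X) (\<lambda>i. f (Matrix.row X i))"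

abbreviation sqrt_weights ::
  "real Matrix.mat \<Rightarrow> (real Matrix.vec \<Rightarrow> real) \<Rightarrow> real Matrix.mat" where
  "sqrt_weights X w \<equiv> row_diag X (\<lambda>x. sqrt (w x))"

definition mean_weight :: "real Matrix.mat \<Rightarrow> (real Matrix.vec \<Rightarrow> real) \<Rightarrow> real" where
  "mean_weight X w = (\<Sum>i<dim_row X. w (Matrix.row X i)) / real (dim_row X)"

text \<open>
  The variables are labelled in order of entry, so the design matrix of the model of
  size \<open>p\<close> consists of the first \<open>p\<close> columns of \<open>X\<close>.
\<close>

definition subset_design :: "real Matrix.mat \<Rightarrow> nat \<Rightarrow> real Matrix.mat" where
  "subset_design X p = mat_of_cols (dim_row X) (take p (cols X))"

definition wls_hat ::
  "real Matrix.mat \<Rightarrow> (real Matrix.vec \<Rightarrow> real) \<Rightarrow> nat \<Rightarrow> real Matrix.mat" where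
  "wls_hat X w p =
     (let Xp = subset_design X p; W = row_diag X w
      in Xp * mat_inv (Xp\<^sup>T * W * Xp) * Xp\<^sup>T * W)"

definition df_F ::
  "real Matrix.mat \<Rightarrow> (real Matrix.vec \<Rightarrow> real) \<Rightarrow> (real Matrix.vec \<Rightarrow> real) \<Rightarrow> nat \<Rightarrow> real" where
  "df_F X w \<tau> p =
     1 / mean_weight X w * mat_trace (wls_hat X w p * row_diag X \<tau> * row_diag X w)"

definition scaled_design ::
  "real Matrix.mat \<Rightarrow> (real Matrix.vec \<Rightarrow> real) \<Rightarrow> nat \<Rightarrow> real Matrix.mat" where
  "scaled_design X w p =
     (1 / sqrt (mean_weight X w)) \<cdot>\<^sub>m (sqrt_weights X w * subset_design X p)"

text \<open>
  Columns are counted from 0: the variable entering after the first \<open>p\<close> ones, with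
  label \<open>p + 1\<close>, is \<open>col X p\<close>.
\<close>

definition scaled_next_col ::
  "real Matrix.mat \<Rightarrow> (real Matrix.vec \<Rightarrow> real) \<Rightarrow> nat \<Rightarrow> real Matrix.vec" where
  "scaled_next_col X w p =
     (1 / sqrt (mean_weight X w)) \<cdot>\<^sub>v (sqrt_weights X w *\<^sub>v col X p)"

definition scaled_hat ::
  "real Matrix.mat \<Rightarrow> (real Matrix.vec \<Rightarrow> real) \<Rightarrow> nat \<Rightarrow> real Matrix.mat" where
  "scaled_hat X w p =
     (let Xp = scaled_design X w p in Xp * mat_inv (Xp\<^sup>T * Xp) * Xp\<^sup>T)"

definition next_residual ::
  "real Matrix.mat \<Rightarrow> (real Matrix.vec \<Rightarrow> real) \<Rightarrow> nat \<Rightarrow> real Matrix.vec" where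
  "next_residual X w p = (1\<^sub>m (dim_row X) - scaled_hat X w p) *\<^sub>v scaled_next_col X w p"

definition U_mat ::
  "real Matrix.mat \<Rightarrow> (real Matrix.vec \<Rightarrow> real) \<Rightarrow> (real Matrix.vec \<Rightarrow> real) \<Rightarrow> real Matrix.mat" where
  "U_mat X w \<tau> =
     (1 / mean_weight X w) \<cdot>\<^sub>m (sqrt_weights X w * row_diag X \<tau> * sqrt_weights X w)"

end

theory Submission
  imports Defs
begin

text \<open>
  The weighted problem is the unweighted one for the design with rows scaled by
  \<open>sqrt (w\<^sub>i / mean w)\<close>, and \<open>df_F\<close> is the trace of the orthogonal projection onto the
  first \<open>p\<close> scaled columns times the positive diagonal matrix \<open>U\<close>. Adding a column adds
  to the projection the rank-one projection \<open>r r\<^sup>T / (r \<bullet> r)\<close> onto the residual \<open>r\<close> of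
  that column, whose trace against \<open>U\<close> is \<open>r\<^sup>T U r / (r \<bullet> r) > 0\<close>.
\<close>

section \<open>Inverses, trivial kernels and Gram matrices\<close>

lemma mat_inv_eqI:
  assumes A: "A \<in> carrier_mat k k" and B: "B \<in> carrier_mat k k" and AB: "A * B = 1\<^sub>m k"
  shows "mat_inv A = B"
proof -
  have BA: "B * A = 1\<^sub>m k"
    by (rule mat_mult_left_right_inverse[OF A B AB])
  \<comment> \<open>Being a unit of the matrix ring excludes the value \<open>None\<close>, so
    \<open>the\<close> in \<open>mat_inv\<close> is applied to a genuine inverse.\<close>
  have "A \<in> Units (ring_mat TYPE(real) k ())"
    using A B AB BA unfolding Units_def ring_mat_def by auto
  then obtain C where C: "mat_inverse A = Some C"
    using mat_inverse(1)[OF A, of "()"] by (cases "mat_inverse A") auto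
  note C' = mat_inverse(2)[OF A C]
  have "C = (B * A) * C" using C' by (simp add: BA left_mult_one_mat[of C k k])
  also have "\<dots> = B * (A * C)" by (rule assoc_mult_mat[OF B A, of C k]) (use C' in simp)
  also have "\<dots> = B" using B C' by simp
  finally show ?thesis unfolding mat_inv_def C by simp
qed

text \<open>Full column rank, phrased as a trivial kernel: in this form it passes to Gram matrices,
  leading columns and row scalings by following a single kernel vector.\<close>

definition injective_mat :: "real Matrix.mat \<Rightarrow> bool" where
  "injective_mat A \<longleftrightarrow>
     (\<forall>v\<in>carrier_vec (dim_col A). A *\<^sub>v v = 0\<^sub>v (dim_row A) \<longrightarrow> v = 0\<^sub>v (dim_col A))"

text \<open>A nonzero kernel vector is a linear dependence among the columns, whereas rank
  \<open>k\<close> makes the \<open>k\<close> columns independent.\<close>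

lemma full_column_rank_injective:
  assumes A: "A \<in> carrier_mat n k" and rank: "vec_space.rank n A = k"
  shows "injective_mat A"
proof (rule ccontr)
  assume "\<not> injective_mat A"
  then obtain v where v: "v \<in> carrier_vec k" "v \<noteq> 0\<^sub>v k" "A *\<^sub>v v = 0\<^sub>v n"
    using A unfolding injective_mat_def by auto
  interpret vec_space "TYPE(real)" n .
  obtain S where S: "maximal S (\<lambda>T. T \<subseteq> set (cols A) \<and> lin_indpt T)"
    using maximal_exists[of "\<lambda>T. T \<subseteq> set (cols A) \<and> lin_indpt T" "card (set (cols A))" "{}"]
    by (meson List.finite_set card_mono empty_iff empty_subsetI finite_lin_indpt2 rev_finite_subset)
  \<comment> \<open>Independence is stated for the set of columns, so repetitions have to be
    excluded first: a maximal independent subset already has \<open>k\<close> elements, hence the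
    \<open>k\<close> columns are distinct.\<close>
  have "k = card S" using rank_card_indpt[OF A S] rank by simp
  also have "\<dots> \<le> card (set (cols A))"
    using S by (intro card_mono) (auto simp: maximal_def)
  finally have "length (cols A) \<le> card (set (cols A))" using A by simp
  then have "distinct (cols A)" by (intro card_distinct antisym card_length)
  then show False
    using full_rank_lin_indpt[OF A rank] lin_depI[OF A v] by blast
qed

text \<open>A square matrix with determinant zero has a nonzero kernel vector, so injectivity gives
  a nonzero determinant and therefore a unit.\<close>

lemma mat_inv_injective:
  assumes A: "A \<in> carrier_mat k k" and inj: "injective_mat A"
  shows "mat_inv A \<in> carrier_mat k k" "A * mat_inv A = 1\<^sub>m k" "mat_inv A * A = 1\<^sub>m k"
proof -
  have "Determinant.det A \<noteq> 0"
    using det_0_iff_vec_prod_zero[OF A] inj A unfolding injective_mat_def by auto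
  then have "A \<in> Units (ring_mat TYPE(real) k ())"
    by (rule det_non_zero_imp_unit[OF A])
  then obtain C where C: "mat_inverse A = Some C"
    using mat_inverse(1)[OF A, of "()"] by (cases "mat_inverse A") auto
  show "mat_inv A \<in> carrier_mat k k" "A * mat_inv A = 1\<^sub>m k" "mat_inv A * A = 1\<^sub>m k"
    using mat_inverse(2)[OF A C] unfolding mat_inv_def C by auto
qed

lemma scalar_prod_self:
  fixes v :: "real Matrix.vec"
  shows "v \<bullet> v = (\<Sum>i<dim_vec v. (v $ i)\<^sup>2)"
  unfolding scalar_prod_def by (simp add: power2_eq_square atLeast0LessThan)

lemma scalar_prod_self_eq_0:
  fixes v :: "real Matrix.vec"
  assumes v: "v \<in> carrier_vec n" and zero: "v \<bullet> v = 0"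
  shows "v = 0\<^sub>v n"
proof (rule eq_vecI)
  fix i assume "i < dim_vec (0\<^sub>v n)"
  moreover have "\<forall>i\<in>{..<dim_vec v}. (v $ i)\<^sup>2 = 0"
    using zero unfolding scalar_prod_self by (subst (asm) sum_nonneg_eq_0_iff) auto
  ultimately show "v $ i = 0\<^sub>v n $ i" using v by auto
qed (use v in auto)

text \<open>Pairing the image of \<open>v\<close> under the Gram matrix with \<open>v\<close> gives
  the squared length of \<open>A *\<^sub>v v\<close>, which over the reals vanishes only for the
  zero vector.\<close>

lemma gram_injective:
  assumes A: "A \<in> carrier_mat n k" and inj: "injective_mat A"
  shows "injective_mat (A\<^sup>T * A)"
  unfolding injective_mat_def
proof (intro ballI impI)
  fix v assume v': "v \<in> carrier_vec (dim_col (A\<^sup>T * A))"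
    and zero: "(A\<^sup>T * A) *\<^sub>v v = 0\<^sub>v (dim_row (A\<^sup>T * A))"
  have v: "v \<in> carrier_vec k" using v' A by simp
  have Av: "A *\<^sub>v v \<in> carrier_vec n" using A v by simp
  have 0: "A\<^sup>T *\<^sub>v (A *\<^sub>v v) = 0\<^sub>v k"
    using assoc_mult_mat_vec[of "A\<^sup>T" k n A k v] zero A v by simp
  have "(A *\<^sub>v v) \<bullet> (A *\<^sub>v v) = (A\<^sup>T *\<^sub>v (A *\<^sub>v v)) \<bullet> v"
    by (rule transpose_vec_mult_scalar[OF A v Av, symmetric])
  also have "\<dots> = 0" using v unfolding 0 by simp
  finally have "A *\<^sub>v v = 0\<^sub>v n" by (rule scalar_prod_self_eq_0[OF Av])
  then show "v = 0\<^sub>v (dim_col (A\<^sup>T * A))"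
    using inj A v unfolding injective_mat_def by auto
qed

section \<open>Hat matrices as orthogonal projections onto column spaces\<close>

definition hat_mat :: "real Matrix.mat \<Rightarrow> real Matrix.mat" where
  "hat_mat A = A * mat_inv (A\<^sup>T * A) * A\<^sup>T"

context
  fixes A :: "real Matrix.mat" and n k :: nat
  assumes A: "A \<in> carrier_mat n k" and inj: "injective_mat A"
begin

lemma gram_carrier: "A\<^sup>T * A \<in> carrier_mat k k"
  using A by simp

lemmas gram_inv = mat_inv_injective[OF gram_carrier gram_injective[OF A inj]]

lemma hat_mat_carrier: "hat_mat A \<in> carrier_mat n n"
  using A gram_inv(1) unfolding hat_mat_def by simp

lemma hat_mat_mult: "hat_mat A * A = A"
proof -
  have "hat_mat A * A = A * (mat_inv (A\<^sup>T * A) * (A\<^sup>T * A))"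
    using A gram_inv(1) unfolding hat_mat_def
    by (simp add: assoc_mult_mat[of _ n k _ n _ k] assoc_mult_mat[of _ n k _ k _ n]
        assoc_mult_mat[of _ k k _ n _ k] assoc_mult_mat[of _ n k _ k _ k])
  then show ?thesis using A gram_inv(3) by simp
qed

text \<open>The Gram matrix is symmetric, so the transpose of its inverse is again a right inverse,
  and right inverses are unique.\<close>

lemma gram_inv_symmetric: "(mat_inv (A\<^sup>T * A))\<^sup>T = mat_inv (A\<^sup>T * A)"
proof -
  have "(A\<^sup>T * A) * (mat_inv (A\<^sup>T * A))\<^sup>T = (mat_inv (A\<^sup>T * A) * (A\<^sup>T * A))\<^sup>T"
    using A gram_inv(1) by (simp add: transpose_mult[of _ k k _ k] transpose_mult[of _ k n _ k])
  also have "\<dots> = 1\<^sub>m k" by (simp add: gram_inv(3))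
  finally show ?thesis
    using mat_inv_eqI[OF gram_carrier, of "(mat_inv (A\<^sup>T * A))\<^sup>T"] gram_inv(1) by simp
qed

lemma hat_mat_symmetric: "(hat_mat A)\<^sup>T = hat_mat A"
proof -
  have "(hat_mat A)\<^sup>T = (A\<^sup>T)\<^sup>T * (A * mat_inv (A\<^sup>T * A))\<^sup>T"
    unfolding hat_mat_def by (rule transpose_mult[of _ n k _ n]) (use A gram_inv(1) in auto)
  also have "\<dots> = A * (A * mat_inv (A\<^sup>T * A))\<^sup>T" by simp
  also have "\<dots> = A * (mat_inv (A\<^sup>T * A) * A\<^sup>T)"
    using A gram_inv(1) gram_inv_symmetric by (simp add: transpose_mult[of _ n k _ k])
  finally show ?thesis
    using A gram_inv(1) unfolding hat_mat_def by (simp add: assoc_mult_mat[of _ n k _ k _ n])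
qed

text \<open>The leftmost factor of \<open>hat_mat A\<close> is \<open>A\<close> itself, so whatever
  fixes the columns of \<open>A\<close> fixes the projection. This yields idempotence for
  \<open>S = hat_mat A\<close>, and the nesting of projections when \<open>S\<close> belongs to a
  larger model.\<close>

lemma mult_hat_mat:
  assumes S: "S \<in> carrier_mat m n" and SA: "S * A = A"
  shows "S * hat_mat A = hat_mat A"
proof -
  have "S * hat_mat A = (S * A) * mat_inv (A\<^sup>T * A) * A\<^sup>T"
    using A S gram_inv(1) unfolding hat_mat_def
    by (simp add: assoc_mult_mat[of _ m n _ k _ k] assoc_mult_mat[of _ m n _ k _ n])
  then show ?thesis unfolding SA hat_mat_def .
qed

text \<open>Uniqueness of the orthogonal projection. Fixing the columns of \<open>A\<close> gives
  \<open>S * hat_mat A = hat_mat A\<close>; transposing gives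
  \<open>hat_mat A * S = hat_mat A\<close>, and the range condition says that the same product is
  \<open>S\<close>.\<close>

lemma hat_mat_eqI:
  assumes S: "S \<in> carrier_mat n n" and sym: "S\<^sup>T = S" and SA: "S * A = A"
    and range: "hat_mat A * S = S"
  shows "hat_mat A = S"
proof -
  have "hat_mat A = (S * hat_mat A)\<^sup>T"
    by (simp add: mult_hat_mat[OF S SA] hat_mat_symmetric)
  also have "\<dots> = hat_mat A * S"
    using S hat_mat_carrier by (simp add: transpose_mult[of _ n n _ n] hat_mat_symmetric sym)
  finally show ?thesis using range by simp
qed

end

section \<open>Leading columns of a design\<close>

lemma mult_mat_unit_vec:
  fixes A :: "real Matrix.mat"
  assumes "A \<in> carrier_mat n k" "j < k"
  shows "A *\<^sub>v unit_vec k j = col A j"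
  using assms by (intro eq_vecI) (auto simp: scalar_prod_right_unit)

lemma subset_design_carrier:
  "Z \<in> carrier_mat n d \<Longrightarrow> p \<le> d \<Longrightarrow> subset_design Z p \<in> carrier_mat n p"
  unfolding subset_design_def using mat_of_cols_carrier(1)[of n "take p (cols Z)"] by auto

lemma subset_design_index:
  "Z \<in> carrier_mat n d \<Longrightarrow> p \<le> d \<Longrightarrow> i < n \<Longrightarrow> j < p \<Longrightarrow> subset_design Z p $$ (i, j) = Z $$ (i, j)"
  unfolding subset_design_def by (auto simp: mat_of_cols_index)

lemma col_subset_design:
  assumes "Z \<in> carrier_mat n d" "p \<le> d" "j < p"
  shows "col (subset_design Z p) j = col Z j"
  using assms subset_design_carrier[OF assms(1,2)]
  by (intro eq_vecI) (auto simp: subset_design_index)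

text \<open>Padding coefficients with zeros turns a combination of the first \<open>p\<close>
  columns into one of all columns, where injectivity of \<open>Z\<close> applies.\<close>

lemma subset_design_mult_vec:
  assumes Z: "Z \<in> carrier_mat n d" and p: "p \<le> d" and v: "v \<in> carrier_vec p"
  shows "subset_design Z p *\<^sub>v v = Z *\<^sub>v Matrix.vec d (\<lambda>i. if i < p then v $ i else 0)"
proof (rule eq_vecI)
  note sd = subset_design_carrier[OF Z p]
  fix i assume "i < dim_vec (Z *\<^sub>v Matrix.vec d (\<lambda>i. if i < p then v $ i else 0))"
  then have i: "i < n" using Z by simp
  have "(subset_design Z p *\<^sub>v v) $ i = (\<Sum>j<p. Z $$ (i, j) * v $ j)"
    using sd v i Z p by (simp add: scalar_prod_def atLeast0LessThan subset_design_index)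
  also have "\<dots> = (\<Sum>j<d. Z $$ (i, j) * (if j < p then v $ j else 0))"
    using p by (intro sum.mono_neutral_cong_left) auto
  finally show "(subset_design Z p *\<^sub>v v) $ i = (Z *\<^sub>v Matrix.vec d (\<lambda>i. if i < p then v $ i else 0)) $ i"
    using Z i by (simp add: scalar_prod_def atLeast0LessThan)
qed (use Z subset_design_carrier[OF Z p] in auto)

lemma subset_design_injective:
  assumes Z: "Z \<in> carrier_mat n d" and inj: "injective_mat Z" and p: "p \<le> d"
  shows "injective_mat (subset_design Z p)"
  unfolding injective_mat_def
proof (intro ballI impI)
  note sd = subset_design_carrier[OF Z p]
  fix v assume v: "v \<in> carrier_vec (dim_col (subset_design Z p))"
    and zero: "subset_design Z p *\<^sub>v v = 0\<^sub>v (dim_row (subset_design Z p))"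
  have v': "v \<in> carrier_vec p" using v sd by simp
  let ?e = "Matrix.vec d (\<lambda>i. if i < p then v $ i else 0)"
  have "Z *\<^sub>v ?e = 0\<^sub>v n"
    using zero sd subset_design_mult_vec[OF Z p v'] by simp
  then have e: "?e = 0\<^sub>v d" using inj Z unfolding injective_mat_def by auto
  have "v $ i = 0" if "i < p" for i
    using arg_cong[OF e, of "\<lambda>u. u $ i"] that p by simp
  then show "v = 0\<^sub>v (dim_col (subset_design Z p))" using v' sd by (intro eq_vecI) auto
qed

section \<open>Rank-one update of the projection when a column enters\<close>

definition outer_square :: "real Matrix.vec \<Rightarrow> real Matrix.mat" where
  "outer_square r = Matrix.mat (dim_vec r) (dim_vec r) (\<lambda>(i, j). r $ i * r $ j / (r \<bullet> r))"

lemma outer_square_carrier: "r \<in> carrier_vec n \<Longrightarrow> outer_square r \<in> carrier_mat n n"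
  unfolding outer_square_def by auto

lemma outer_square_symmetric: "(outer_square r)\<^sup>T = outer_square r"
  unfolding outer_square_def by (rule eq_matI) auto

text \<open>For nonzero \<open>r\<close> the right-hand side is the orthogonal projection of
  \<open>x\<close> onto the line spanned by \<open>r\<close>.\<close>

lemma outer_square_mult_vec:
  assumes "r \<in> carrier_vec n" "x \<in> carrier_vec n"
  shows "outer_square r *\<^sub>v x = ((r \<bullet> x) / (r \<bullet> r)) \<cdot>\<^sub>v r"
proof (rule eq_vecI)
  fix i assume "i < dim_vec (((r \<bullet> x) / (r \<bullet> r)) \<cdot>\<^sub>v r)"
  then have i: "i < n" using assms by simp
  \<comment> \<open>Naming the denominator keeps it intact while the other scalar products are
    unfolded into sums.\<close>
  define q where "q = r \<bullet> r"
  have "(outer_square r *\<^sub>v x) $ i = (\<Sum>j<n. r $ i * r $ j / q * x $ j)"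
    using assms i unfolding outer_square_def q_def[symmetric]
    by (simp add: scalar_prod_def atLeast0LessThan)
  also have "\<dots> = (\<Sum>j<n. r $ j * x $ j) / q * r $ i"
    by (simp add: sum_divide_distrib sum_distrib_left mult_ac)
  also have "(\<Sum>j<n. r $ j * x $ j) = r \<bullet> x"
    using assms by (simp add: scalar_prod_def atLeast0LessThan)
  finally show "(outer_square r *\<^sub>v x) $ i = (((r \<bullet> x) / (r \<bullet> r)) \<cdot>\<^sub>v r) $ i"
    using i assms by (simp add: q_def)
qed (use assms in \<open>auto simp: outer_square_def\<close>)

text \<open>Unweighted counterpart of \<open>next_residual\<close>. Since columns count from 0,
  \<open>col Z p\<close> is the first column outside the model of size \<open>p\<close>.\<close>

definition residual :: "real Matrix.mat \<Rightarrow> nat \<Rightarrow> real Matrix.vec" where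
  "residual Z p = (1\<^sub>m (dim_row Z) - hat_mat (subset_design Z p)) *\<^sub>v col Z p"

context
  fixes Z :: "real Matrix.mat" and n d p :: nat
  assumes Z: "Z \<in> carrier_mat n d" and inj: "injective_mat Z" and p: "p < d"
begin

lemmas sd_carrier = subset_design_carrier[OF Z less_imp_le[OF p]]
lemmas sd_inj = subset_design_injective[OF Z inj less_imp_le[OF p]]
lemmas hat_carrier = hat_mat_carrier[OF sd_carrier sd_inj]

lemma next_col_carrier: "col Z p \<in> carrier_vec n"
  using Z p by auto

lemma residual_carrier: "residual Z p \<in> carrier_vec n"
  using hat_carrier next_col_carrier Z unfolding residual_def
  by (intro mult_mat_vec_carrier minus_carrier_mat)

lemma residual_eq: "residual Z p = col Z p - hat_mat (subset_design Z p) *\<^sub>v col Z p"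
  using hat_carrier next_col_carrier Z unfolding residual_def
  by (simp add: minus_mult_distrib_mat_vec[of _ n n])

lemma next_col_eq: "hat_mat (subset_design Z p) *\<^sub>v col Z p + residual Z p = col Z p"
  using hat_carrier next_col_carrier Z unfolding residual_eq by (intro eq_vecI) auto

lemma hat_idempotent:
  "hat_mat (subset_design Z p) * hat_mat (subset_design Z p) = hat_mat (subset_design Z p)"
  by (rule mult_hat_mat[OF sd_carrier sd_inj hat_carrier hat_mat_mult[OF sd_carrier sd_inj]])

lemma hat_residual: "hat_mat (subset_design Z p) *\<^sub>v residual Z p = 0\<^sub>v n"
  using hat_carrier next_col_carrier
    assoc_mult_mat_vec[OF hat_carrier hat_carrier next_col_carrier]
  unfolding residual_eq by (simp add: mult_minus_distrib_mat_vec[of _ n n] hat_idempotent)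

text \<open>The projection is symmetric and can be moved to the residual, which it
  annihilates.\<close>

lemma residual_orthogonal_range:
  assumes x: "x \<in> carrier_vec n"
  shows "residual Z p \<bullet> (hat_mat (subset_design Z p) *\<^sub>v x) = 0"
proof -
  have "((hat_mat (subset_design Z p))\<^sup>T *\<^sub>v residual Z p) \<bullet> x
      = residual Z p \<bullet> (hat_mat (subset_design Z p) *\<^sub>v x)"
    by (rule transpose_vec_mult_scalar[OF hat_carrier x residual_carrier])
  then show ?thesis
    using x by (simp add: hat_mat_symmetric[OF sd_carrier sd_inj] hat_residual)
qed

text \<open>The fitted part of the new column is orthogonal to the residual. Consequently
  \<open>outer_square\<close> of the residual sends the new column to the residual with coefficient
  exactly 1.\<close>

lemma residual_next_col: "residual Z p \<bullet> col Z p = residual Z p \<bullet> residual Z p"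
proof -
  have "residual Z p \<bullet> col Z p
      = residual Z p \<bullet> (hat_mat (subset_design Z p) *\<^sub>v col Z p) + residual Z p \<bullet> residual Z p"
    using hat_carrier next_col_carrier residual_carrier
    by (subst next_col_eq[symmetric]) (simp add: scalar_prod_add_distrib[of _ n])
  then show ?thesis using residual_orthogonal_range[OF next_col_carrier] by simp
qed

text \<open>A zero residual would make the new column a combination of the earlier ones, against the
  injectivity of \<open>Z\<close>.\<close>

lemma residual_nonzero: "residual Z p \<noteq> 0\<^sub>v n"
proof
  assume zero: "residual Z p = 0\<^sub>v n"
  let ?A = "subset_design Z p"
  \<comment> \<open>Least squares coefficients of the new column regressed on the first
    \<open>p\<close> columns.\<close>
  define c where "c = mat_inv (?A\<^sup>T * ?A) * ?A\<^sup>T *\<^sub>v col Z p"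
  note K = gram_inv(1)[OF sd_carrier sd_inj]
  have c: "c \<in> carrier_vec p"
    using K sd_carrier next_col_carrier unfolding c_def by simp
  let ?e = "Matrix.vec d (\<lambda>i. if i < p then c $ i else 0)"
  have "Z *\<^sub>v ?e = ?A *\<^sub>v c"
    by (rule subset_design_mult_vec[OF Z less_imp_le[OF p] c, symmetric])
  also have "\<dots> = hat_mat ?A *\<^sub>v col Z p"
    using K sd_carrier next_col_carrier assoc_mult_mat_vec[of ?A n p "mat_inv (?A\<^sup>T * ?A) * ?A\<^sup>T" n "col Z p"]
    unfolding c_def hat_mat_def
    by (simp add: assoc_mult_mat[of ?A n p "mat_inv (?A\<^sup>T * ?A)" p "?A\<^sup>T" n])
  also have "\<dots> = col Z p"
    using next_col_eq hat_carrier next_col_carrier unfolding zero by simp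
  also have "\<dots> = Z *\<^sub>v unit_vec d p"
    using Z p by (simp add: mult_mat_unit_vec)
  finally have "Z *\<^sub>v (?e - unit_vec d p) = 0\<^sub>v n"
    using Z by (simp add: mult_minus_distrib_mat_vec[of _ n d])
  then have "?e - unit_vec d p = 0\<^sub>v d"
    using inj Z unfolding injective_mat_def by auto
  \<comment> \<open>At coordinate \<open>p\<close> the padded vector is 0 and the unit vector is 1,
    so the difference cannot vanish.\<close>
  from arg_cong[OF this, of "\<lambda>u. u $ p"] show False using p by simp
qed

lemma residual_sq_pos: "residual Z p \<bullet> residual Z p > 0"
proof -
  have "residual Z p \<bullet> residual Z p \<noteq> 0"
    using scalar_prod_self_eq_0[OF residual_carrier] residual_nonzero by blast
  moreover have "residual Z p \<bullet> residual Z p \<ge> 0"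
    unfolding scalar_prod_self by (intro sum_nonneg) auto
  ultimately show ?thesis by simp
qed

text \<open>The sum on the right is symmetric, fixes each of the first \<open>p + 1\<close> columns
  and has its range in their span; \<open>hat_mat_eqI\<close> then identifies it with the larger
  projection.\<close>

lemma hat_mat_update:
  "hat_mat (subset_design Z (Suc p)) = hat_mat (subset_design Z p) + outer_square (residual Z p)"
proof -
  let ?A = "subset_design Z p" and ?B = "subset_design Z (Suc p)"
  let ?P = "hat_mat ?A" and ?Q = "hat_mat ?B" and ?R = "outer_square (residual Z p)"
  have B: "?B \<in> carrier_mat n (Suc p)" using subset_design_carrier[OF Z, of "Suc p"] p by simp
  have injB: "injective_mat ?B" using subset_design_injective[OF Z inj] p by simp
  have R: "?R \<in> carrier_mat n n" by (rule outer_square_carrier[OF residual_carrier])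
  note P = hat_carrier and Q = hat_mat_carrier[OF B injB]
  have S: "?P + ?R \<in> carrier_mat n n" using P R by simp
  have Sv: "(?P + ?R) *\<^sub>v x
      = ?P *\<^sub>v x + ((residual Z p \<bullet> x) / (residual Z p \<bullet> residual Z p)) \<cdot>\<^sub>v residual Z p"
    if "x \<in> carrier_vec n" for x
    using P R that residual_carrier
    by (simp add: add_mult_distrib_mat_vec[of _ n n] outer_square_mult_vec)
  have Pcol: "?P *\<^sub>v col Z j = col Z j" if "j < p" for j
  proof -
    have "?P *\<^sub>v col ?A j = col (?P * ?A) j"
      by (rule col_mult2[OF P sd_carrier that, symmetric])
    then show ?thesis
      using that Z p by (simp add: hat_mat_mult[OF sd_carrier sd_inj] col_subset_design)
  qed
  have Qcol: "?Q *\<^sub>v col Z j = col Z j" if "j < Suc p" for j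
  proof -
    have "?Q *\<^sub>v col ?B j = col (?Q * ?B) j"
      by (rule col_mult2[OF Q B that, symmetric])
    then show ?thesis
      using that Z p by (simp add: hat_mat_mult[OF B injB] col_subset_design)
  qed
  \<comment> \<open>Earlier columns are fixed by \<open>?P\<close> and orthogonal to the residual.
    For the new column, \<open>?P\<close> supplies the fitted part and \<open>?R\<close> the
    residual.\<close>
  have SB: "(?P + ?R) * ?B = ?B"
  proof (rule mat_col_eqI)
    fix j assume "j < dim_col ?B"
    then have j: "j < Suc p" using B by simp
    have colj: "col Z j \<in> carrier_vec n" using Z by auto
    have "(?P + ?R) *\<^sub>v col Z j = col Z j"
    proof (cases "j < p")
      case True
      have "residual Z p \<bullet> col Z j = 0"
        using residual_orthogonal_range[OF colj] Pcol[OF True] by simp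
      moreover have "col Z j + 0 \<cdot>\<^sub>v residual Z p = col Z j"
        using colj residual_carrier Z by (intro eq_vecI) auto
      ultimately show ?thesis
        using Sv[OF colj] Pcol[OF True] by simp
    next
      case False
      then have "j = p" using j by simp
      then show ?thesis
        using Sv[OF colj] next_col_eq residual_sq_pos by (simp add: residual_next_col)
    qed
    then show "col ((?P + ?R) * ?B) j = col ?B j"
      using col_mult2[OF S B j] j Z p by (simp add: col_subset_design)
  qed (use S B in auto)
  have QA: "?Q * ?A = ?A"
  proof (rule mat_col_eqI)
    fix j assume "j < dim_col ?A"
    then have j: "j < p" using sd_carrier by simp
    then show "col (?Q * ?A) j = col ?A j"
      using col_mult2[OF Q sd_carrier j] j Z p Qcol[of j] by (simp add: col_subset_design)
  qed (use Q sd_carrier in auto)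
  have QP: "?Q * ?P = ?P" by (rule mult_hat_mat[OF sd_carrier sd_inj Q QA])
  \<comment> \<open>The residual is the new column minus its fitted value, and \<open>?Q\<close>
    fixes both.\<close>
  have Qr: "?Q *\<^sub>v residual Z p = residual Z p"
    using Q P next_col_carrier Qcol[of p] assoc_mult_mat_vec[OF Q P next_col_carrier]
    unfolding residual_eq by (simp add: mult_minus_distrib_mat_vec[of _ n n] QP)
  have QR: "?Q * ?R = ?R"
  proof (rule mat_col_eqI)
    fix j assume "j < dim_col ?R"
    then have j: "j < n" using R by simp
    have e: "unit_vec n j \<in> carrier_vec n" by simp
    \<comment> \<open>Every column of \<open>?R\<close> is a multiple of the residual, so
      \<open>?Q\<close> fixes it.\<close>
    have "col ?R j = ?R *\<^sub>v unit_vec n j" using R j by (simp add: mult_mat_unit_vec)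
    then have "\<exists>c. col ?R j = c \<cdot>\<^sub>v residual Z p"
      using outer_square_mult_vec[OF residual_carrier e] by metis
    then show "col (?Q * ?R) j = col ?R j"
      using col_mult2[OF Q R j] mult_mat_vec[OF Q residual_carrier] Qr by auto
  qed (use Q R in auto)
  show ?thesis
  proof (rule hat_mat_eqI[OF B injB S _ SB])
    show "(?P + ?R)\<^sup>T = ?P + ?R"
      using P R by (simp add: transpose_add hat_mat_symmetric[OF sd_carrier sd_inj] outer_square_symmetric)
    show "?Q * (?P + ?R) = ?P + ?R"
      using Q P R by (simp add: mult_add_distrib_mat[of _ n n _ n] QP QR)
  qed
qed

end

section \<open>Reduction of the weighted problem to the row-scaled design\<close>

lemma transpose_mat_diag: "(mat_diag n f)\<^sup>T = mat_diag n f"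
  unfolding mat_diag_def by (rule eq_matI) auto

lemma mat_diag_mult_vec_index:
  fixes x :: "real Matrix.vec"
  assumes "x \<in> carrier_vec n" "i < n"
  shows "(mat_diag n f *\<^sub>v x) $ i = f i * x $ i"
proof -
  have "(mat_diag n f *\<^sub>v x) $ i = (\<Sum>j<n. (if i = j then f j else 0) * x $ j)"
    using assms unfolding mat_diag_def by (simp add: scalar_prod_def atLeast0LessThan)
  also have "\<dots> = (\<Sum>j<n. if i = j then f j * x $ j else 0)"
    by (intro sum.cong) auto
  finally show ?thesis using assms by simp
qed

context
  fixes n d :: nat and X :: "real Matrix.mat" and w :: "real Matrix.vec \<Rightarrow> real"
  assumes X: "X \<in> carrier_mat n d" and d_less_n: "d < n"
    and w_pos: "\<And>x. x \<in> carrier_vec d \<Longrightarrow> w x > 0"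
begin

definition "row_scale i = sqrt (w (Matrix.row X i)) / sqrt (mean_weight X w)"

text \<open>The whole design is scaled once; the scaled models of all sizes are then its leading
  columns, and the unweighted results apply to each of them.\<close>

definition "scaled_mat = mat_diag n row_scale * X"

lemma weight_pos: "i < n \<Longrightarrow> w (Matrix.row X i) > 0"
  using X by (intro w_pos) auto

text \<open>From \<open>d < n\<close> there is at least one row, so the mean is taken over a
  nonempty set of positive weights.\<close>

lemma mean_weight_pos: "mean_weight X w > 0"
  unfolding mean_weight_def using X d_less_n
  by (intro divide_pos_pos sum_pos) (auto intro: weight_pos)

lemma row_scale_nonzero: "i < n \<Longrightarrow> row_scale i \<noteq> 0"
  using weight_pos[of i] mean_weight_pos unfolding row_scale_def by simp

lemma row_scale_sq: "i < n \<Longrightarrow> mean_weight X w * (row_scale i * row_scale i) = w (Matrix.row X i)"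
  using weight_pos[of i] mean_weight_pos unfolding row_scale_def by simp

lemma scaled_mat_carrier: "scaled_mat \<in> carrier_mat n d"
  using X unfolding scaled_mat_def by (intro mult_carrier_mat) auto

lemma scaled_mat_index: "i < n \<Longrightarrow> j < d \<Longrightarrow> scaled_mat $$ (i, j) = row_scale i * X $$ (i, j)"
  using X unfolding scaled_mat_def by (simp add: mat_diag_mult_left[OF X])

lemma row_diag_eq: "row_diag X f = mat_diag n (\<lambda>i. f (Matrix.row X i))"
  using X unfolding row_diag_def by simp

lemma subset_design_scaled_mat:
  assumes p: "p \<le> d"
  shows "subset_design scaled_mat p = mat_diag n row_scale * subset_design X p"
  using subset_design_carrier[OF scaled_mat_carrier p]
  by (intro eq_matI) (auto simp: mat_diag_mult_left[OF subset_design_carrier[OF X p]]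
      subset_design_index[OF X p] subset_design_index[OF scaled_mat_carrier p] scaled_mat_index p
      dest: less_le_trans[OF _ p])

lemma scaled_design_eq:
  assumes p: "p \<le> d"
  shows "scaled_design X w p = subset_design scaled_mat p"
  unfolding subset_design_scaled_mat[OF p] scaled_design_def row_diag_eq
  by (intro eq_matI) (auto simp: mat_diag_mult_left[OF subset_design_carrier[OF X p]] row_scale_def)

lemma scaled_next_col_eq:
  assumes p: "p < d"
  shows "scaled_next_col X w p = col scaled_mat p"
proof -
  have "mat_diag n f *\<^sub>v col X p = col (mat_diag n f * X) p" for f :: "nat \<Rightarrow> real"
    by (rule col_mult2[OF mat_diag_dim X p, symmetric])
  then show ?thesis
    using X p unfolding scaled_next_col_def row_diag_eq scaled_mat_def
    by (intro eq_vecI) (auto simp: mat_diag_mult_left[OF X] row_scale_def)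
qed

lemma next_residual_eq:
  assumes p: "p < d"
  shows "next_residual X w p = residual scaled_mat p"
  using X p scaled_mat_carrier unfolding next_residual_def residual_def scaled_hat_def Let_def hat_mat_def
  by (simp add: scaled_design_eq scaled_next_col_eq)

text \<open>Multiplying the rows by nonzero factors leaves the kernel unchanged.\<close>

lemma scaled_mat_injective:
  assumes inj: "injective_mat X"
  shows "injective_mat scaled_mat"
  unfolding injective_mat_def
proof (intro ballI impI)
  fix v assume "v \<in> carrier_vec (dim_col scaled_mat)"
    and zero: "scaled_mat *\<^sub>v v = 0\<^sub>v (dim_row scaled_mat)"
  then have v: "v \<in> carrier_vec d" using scaled_mat_carrier by simp
  have eq: "scaled_mat *\<^sub>v v = mat_diag n row_scale *\<^sub>v (X *\<^sub>v v)"
    unfolding scaled_mat_def by (rule assoc_mult_mat_vec[OF mat_diag_dim X v])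
  have "X *\<^sub>v v = 0\<^sub>v n"
  proof (rule eq_vecI)
    fix i assume "i < dim_vec (0\<^sub>v n)"
    then have i: "i < n" by simp
    have "(mat_diag n row_scale *\<^sub>v (X *\<^sub>v v)) $ i = 0"
      using zero i scaled_mat_carrier unfolding eq by simp
    then have "row_scale i * (X *\<^sub>v v) $ i = 0"
      using X v i by (subst (asm) mat_diag_mult_vec_index) auto
    then show "(X *\<^sub>v v) $ i = 0\<^sub>v n $ i" using row_scale_nonzero[OF i] i by simp
  qed (use X in simp)
  then show "v = 0\<^sub>v (dim_col scaled_mat)"
    using inj v X scaled_mat_carrier unfolding injective_mat_def by simp
qed

text \<open>With \<open>D\<close> the diagonal matrix of \<open>row_scale\<close> and
  \<open>m\<close> the mean weight, the weight matrix is \<open>m\<close> times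
  \<open>D * D\<close>. The weighted Gram matrix is thus \<open>m\<close> times the Gram matrix of
  the scaled design, and its inverse acquires the factor \<open>1 / m\<close>.\<close>

lemma wls_hat_eq:
  assumes inj: "injective_mat X" and p: "p \<le> d"
  defines "K \<equiv> mat_inv ((subset_design scaled_mat p)\<^sup>T * subset_design scaled_mat p)"
  shows "wls_hat X w p = (1 / mean_weight X w) \<cdot>\<^sub>m
    (subset_design X p * K * (subset_design X p)\<^sup>T * row_diag X w)"
proof -
  let ?D = "mat_diag n row_scale" and ?Xp = "subset_design X p" and ?A = "subset_design scaled_mat p"
  let ?m = "mean_weight X w"
  note Xp = subset_design_carrier[OF X p] and A = subset_design_carrier[OF scaled_mat_carrier p]
  note K = gram_inv[OF A subset_design_injective[OF scaled_mat_carrier scaled_mat_injective[OF inj] p],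
      folded K_def]
  have DD: "?D * ?D \<in> carrier_mat n n" and XpT: "?Xp\<^sup>T \<in> carrier_mat p n"
    using Xp by simp_all
  have W: "row_diag X w = ?m \<cdot>\<^sub>m (?D * ?D)"
    unfolding row_diag_eq mat_diag_diag by (rule eq_matI) (auto simp: mat_diag_def row_scale_sq)
  have "?Xp\<^sup>T * row_diag X w * ?Xp = ?m \<cdot>\<^sub>m (?Xp\<^sup>T * (?D * ?D) * ?Xp)"
    unfolding W mult_smult_distrib[OF XpT DD]
    by (rule mult_smult_assoc_mat[OF mult_carrier_mat[OF XpT DD] Xp])
  also have "?Xp\<^sup>T * (?D * ?D) * ?Xp = ?A\<^sup>T * ?A"
    unfolding subset_design_scaled_mat[OF p] transpose_mult[OF mat_diag_dim Xp] transpose_mat_diag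
      assoc_mult_mat[OF XpT mat_diag_dim mat_diag_dim, symmetric]
    by (rule assoc_mult_mat[OF mult_carrier_mat[OF XpT mat_diag_dim] mat_diag_dim Xp])
  finally have G: "?Xp\<^sup>T * row_diag X w * ?Xp = ?m \<cdot>\<^sub>m (?A\<^sup>T * ?A)" .
  have Kinv: "mat_inv (?m \<cdot>\<^sub>m (?A\<^sup>T * ?A)) = (1 / ?m) \<cdot>\<^sub>m K"
  proof (rule mat_inv_eqI)
    have "(?m \<cdot>\<^sub>m (?A\<^sup>T * ?A)) * ((1 / ?m) \<cdot>\<^sub>m K) = ?m \<cdot>\<^sub>m ((1 / ?m) \<cdot>\<^sub>m ((?A\<^sup>T * ?A) * K))"
      using mult_smult_assoc_mat[of "?A\<^sup>T * ?A" p p "(1 / ?m) \<cdot>\<^sub>m K" p ?m]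
        mult_smult_distrib[of "?A\<^sup>T * ?A" p p K p "1 / ?m"] A K(1) by simp
    also have "\<dots> = 1\<^sub>m p"
      unfolding K(2) using mean_weight_pos by (intro eq_matI) auto
    finally show "(?m \<cdot>\<^sub>m (?A\<^sup>T * ?A)) * ((1 / ?m) \<cdot>\<^sub>m K) = 1\<^sub>m p" .
  qed (use A K(1) in auto)
  note XpK = mult_carrier_mat[OF Xp K(1)]
  have Wc: "row_diag X w \<in> carrier_mat n n" unfolding row_diag_eq by simp
  show ?thesis
    unfolding wls_hat_def Let_def G Kinv
      mult_smult_distrib[OF Xp K(1)] mult_smult_assoc_mat[OF XpK XpT]
    by (rule mult_smult_assoc_mat[OF mult_carrier_mat[OF XpK XpT] Wc])
qed

text \<open>All factors around the common core \<open>N\<close> are diagonal, so the diagonal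
  entries compare one by one: the \<open>i\<close>-th summand of \<open>df_F\<close> is
  \<open>N $$ (i, i)\<close> times the squared weight times the value of \<open>\<tau>\<close>, over
  the squared mean weight, and the \<open>i\<close>-th diagonal entry of the projection is
  \<open>N $$ (i, i)\<close> times the weight over the mean weight.\<close>

lemma df_F_eq_hat_mat:
  assumes inj: "injective_mat X" and p: "p \<le> d"
  shows "df_F X w \<tau> p = (\<Sum>i<n. hat_mat (subset_design scaled_mat p) $$ (i, i)
    * (w (Matrix.row X i) * \<tau> (Matrix.row X i) / mean_weight X w))"
proof -
  let ?D = "mat_diag n row_scale" and ?Xp = "subset_design X p" and ?A = "subset_design scaled_mat p"
  let ?m = "mean_weight X w"
  define K where "K = mat_inv (?A\<^sup>T * ?A)"
  note Xp = subset_design_carrier[OF X p] and A = subset_design_carrier[OF scaled_mat_carrier p]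
  note K = gram_inv(1)[OF A subset_design_injective[OF scaled_mat_carrier scaled_mat_injective[OF inj] p],
      folded K_def]
  define N where "N = ?Xp * K * ?Xp\<^sup>T"
  have N: "N \<in> carrier_mat n n" using Xp K unfolding N_def by simp
  \<comment> \<open>The Gram inverse is folded into \<open>K\<close> before the scaled design is
    expanded, so only the two outer factors are rewritten.\<close>
  have hat: "hat_mat ?A = ?D * N * ?D"
    unfolding hat_mat_def K_def[symmetric] unfolding subset_design_scaled_mat[OF p] N_def
    using Xp K by (simp add: transpose_mult[OF mat_diag_dim Xp] transpose_mat_diag
        assoc_mult_mat[of _ n n _ p _ p] assoc_mult_mat[of _ n n _ p _ n] assoc_mult_mat[of _ n p _ p _ n]
        assoc_mult_mat[of _ n p _ n _ n] assoc_mult_mat[of _ p p _ n _ n] assoc_mult_mat[of _ n n _ n _ n])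
  have hat_ii: "hat_mat ?A $$ (i, i) = row_scale i * N $$ (i, i) * row_scale i" if "i < n" for i
    unfolding hat using that N
    by (simp add: mat_diag_mult_left[OF N] mat_diag_mult_right[of _ n n])
  have "wls_hat X w p = (1 / ?m) \<cdot>\<^sub>m (N * row_diag X w)"
    using wls_hat_eq[OF inj p] unfolding N_def K_def .
  then have wls_ii: "(wls_hat X w p * row_diag X \<tau> * row_diag X w) $$ (i, i)
      = 1 / ?m * (N $$ (i, i) * w (Matrix.row X i)) * \<tau> (Matrix.row X i) * w (Matrix.row X i)"
    if "i < n" for i
    using that unfolding row_diag_eq
    by (simp add: mat_diag_mult_right[OF N] mat_diag_mult_right[of _ n n])
  have "dim_row (wls_hat X w p * row_diag X \<tau> * row_diag X w) = n"
    using X Xp unfolding wls_hat_def Let_def by simp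
  then have "df_F X w \<tau> p = (\<Sum>i<n. 1 / ?m * (1 / ?m * (N $$ (i, i) * w (Matrix.row X i))
      * \<tau> (Matrix.row X i) * w (Matrix.row X i)))"
    unfolding df_F_def mat_trace_def by (simp add: wls_ii sum_distrib_left)
  also have "\<dots> = (\<Sum>i<n. hat_mat ?A $$ (i, i) * (w (Matrix.row X i) * \<tau> (Matrix.row X i) / ?m))"
  proof (rule sum.cong)
    fix i assume "i \<in> {..<n}"
    then have i: "i < n" by simp
    show "1 / ?m * (1 / ?m * (N $$ (i, i) * w (Matrix.row X i)) * \<tau> (Matrix.row X i) * w (Matrix.row X i))
        = hat_mat ?A $$ (i, i) * (w (Matrix.row X i) * \<tau> (Matrix.row X i) / ?m)"
      using mean_weight_pos unfolding hat_ii[OF i] row_scale_sq[OF i, symmetric]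
      by (simp add: field_simps)
  qed simp
  finally show ?thesis .
qed

text \<open>\<open>U\<close> is diagonal, and its entries are exactly the factors multiplying the
  projection diagonal in \<open>df_F_eq_hat_mat\<close>.\<close>

lemma sq_norm_wrt_U_mat:
  assumes r: "r \<in> carrier_vec n"
  shows "sq_norm_wrt (U_mat X w \<tau>) r
    = (\<Sum>i<n. (r $ i)\<^sup>2 * (w (Matrix.row X i) * \<tau> (Matrix.row X i) / mean_weight X w))"
proof -
  let ?u = "\<lambda>i. w (Matrix.row X i) * \<tau> (Matrix.row X i) / mean_weight X w"
  have U: "U_mat X w \<tau> = mat_diag n ?u"
    using weight_pos unfolding U_mat_def row_diag_eq mat_diag_diag
    by (intro eq_matI) (auto simp: mat_diag_def less_imp_le)
  have "(U_mat X w \<tau> *\<^sub>v r) $ i = ?u i * r $ i" if "i < n" for i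
    unfolding U by (rule mat_diag_mult_vec_index[OF r that])
  moreover have "dim_vec (U_mat X w \<tau> *\<^sub>v r) = n" unfolding U mat_diag_def by simp
  ultimately show ?thesis
    unfolding sq_norm_wrt_def scalar_prod_def
    by (auto simp: atLeast0LessThan power2_eq_square mult_ac intro!: sum.cong)
qed

text \<open>By \<open>hat_mat_update\<close> the \<open>i\<close>-th diagonal entry of the
  projection grows by the squared \<open>i\<close>-th residual entry over the squared residual
  length; summing against the diagonal of \<open>U\<close> gives the quotient.\<close>

lemma df_F_increment:
  assumes inj: "injective_mat X" and p: "p < d"
  shows "df_F X w \<tau> (Suc p) - df_F X w \<tau> p
    = sq_norm_wrt (U_mat X w \<tau>) (next_residual X w p) / (euclid_norm (next_residual X w p))\<^sup>2"
proof -
  note Z = scaled_mat_carrier scaled_mat_injective[OF inj] p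
  let ?u = "\<lambda>i. w (Matrix.row X i) * \<tau> (Matrix.row X i) / mean_weight X w"
  let ?r = "residual scaled_mat p" and ?P = "\<lambda>q. hat_mat (subset_design scaled_mat q)"
  note r = residual_carrier[OF Z]
  define q where "q = ?r \<bullet> ?r"
  have q: "q > 0" unfolding q_def by (rule residual_sq_pos[OF Z])
  have "?P (Suc p) $$ (i, i) = ?P p $$ (i, i) + (?r $ i)\<^sup>2 / q" if "i < n" for i
    using that r hat_carrier[OF Z] unfolding hat_mat_update[OF Z] q_def
    by (simp add: outer_square_def power2_eq_square)
  then have "df_F X w \<tau> (Suc p) = (\<Sum>i<n. (?P p $$ (i, i) + (?r $ i)\<^sup>2 / q) * ?u i)"
    using df_F_eq_hat_mat[OF inj, of "Suc p" \<tau>] p by simp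
  also have "\<dots> = df_F X w \<tau> p + (\<Sum>i<n. (?r $ i)\<^sup>2 * ?u i) / q"
    using df_F_eq_hat_mat[OF inj, of p \<tau>] p
    by (simp add: algebra_simps add_divide_distrib sum.distrib sum_divide_distrib)
  finally show ?thesis
    using q unfolding next_residual_eq[OF p] sq_norm_wrt_U_mat[OF r] euclid_norm_def q_def[symmetric]
    by simp
qed

text \<open>The diagonal of \<open>U\<close> is positive and the residual has a nonzero entry, so
  numerator and denominator of the increment are both positive.\<close>

lemma df_F_increment_pos:
  assumes inj: "injective_mat X" and p: "p < d"
    and tau_pos: "\<And>i. i < n \<Longrightarrow> \<tau> (Matrix.row X i) > 0"
  shows "df_F X w \<tau> p < df_F X w \<tau> (Suc p)"
proof -
  note Z = scaled_mat_carrier scaled_mat_injective[OF inj] p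
  let ?r = "residual scaled_mat p"
  note r = residual_carrier[OF Z]
  define u where "u i = w (Matrix.row X i) * \<tau> (Matrix.row X i) / mean_weight X w" for i
  have u: "u i > 0" if "i < n" for i
    using weight_pos[OF that] tau_pos[OF that] mean_weight_pos unfolding u_def by simp
  obtain i where i: "i < n" "?r $ i \<noteq> 0"
    using residual_nonzero[OF Z] r by (metis eq_vecI carrier_vecD index_zero_vec)
  have "sq_norm_wrt (U_mat X w \<tau>) ?r > 0"
    unfolding sq_norm_wrt_U_mat[OF r] u_def[symmetric] using i u
    by (intro sum_pos2[of _ i]) (auto simp: less_imp_le)
  moreover have "(euclid_norm ?r)\<^sup>2 > 0"
    using residual_sq_pos[OF Z] unfolding euclid_norm_def by simp
  ultimately have "df_F X w \<tau> (Suc p) - df_F X w \<tau> p > 0"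
    unfolding df_F_increment[OF inj p] next_residual_eq[OF p] by (rule divide_pos_pos)
  then show ?thesis by simp
qed

end

section \<open>From single increments to strict growth along the whole sequence of models\<close>

theorem theorem4p1:
  fixes n d :: nat
    and X :: "real Matrix.mat"
    and w \<tau> :: "real Matrix.vec \<Rightarrow> real"
    and M :: "'a measure"
    and y :: "nat \<Rightarrow> 'a \<Rightarrow> real"
    and \<sigma> :: real
  assumes X_dim: "X \<in> carrier_mat n d"
    and full_column_rank: "vec_space.rank n X = d"
    and d_less_n: "d < n"
    and w_pos: "\<And>x. x \<in> carrier_vec d \<Longrightarrow> w x > 0"
    and tau_pos: "\<And>i. i < n \<Longrightarrow> \<tau> (Matrix.row X i) > 0"
    and prob: "prob_space M"
    and sigma_pos: "\<sigma>\<^sup>2 > 0"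
    and var_y: "has_covariance_mat M n y (\<sigma>\<^sup>2 \<cdot>\<^sub>m row_diag X \<tau>)"
  shows "strict_mono_on {1..d} (df_F X w \<tau>) \<and>
    (\<forall>p. 1 \<le> p \<and> p < d \<longrightarrow>
      df_F X w \<tau> (p + 1) - df_F X w \<tau> p =
        sq_norm_wrt (U_mat X w \<tau>) (next_residual X w p)
          / (euclid_norm (next_residual X w p))\<^sup>2)"
proof (intro conjI allI impI)
  have inj: "injective_mat X"
    by (rule full_column_rank_injective[OF X_dim full_column_rank])
  have step: "df_F X w \<tau> q < df_F X w \<tau> (Suc q)" if "q < d" for q
    by (rule df_F_increment_pos[OF X_dim d_less_n _ inj that]) (use w_pos tau_pos in auto)
  show "strict_mono_on {1..d} (df_F X w \<tau>)"
  proof (rule strict_mono_onI)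
    fix p q assume pq: "p \<in> {1..d}" "q \<in> {1..d}" "p < q"
    \<comment> \<open>The bound on \<open>q\<close> is kept inside the induction claim, since the
      one-step inequality is available only below \<open>d\<close>; the case \<open>q = 0\<close>
      contradicts \<open>p < q\<close>.\<close>
    have "q \<le> d \<longrightarrow> df_F X w \<tau> p < df_F X w \<tau> q"
      using \<open>p < q\<close>
    proof (induction q)
      case (Suc q)
      show ?case
      proof
        assume q: "Suc q \<le> d"
        then have "df_F X w \<tau> q < df_F X w \<tau> (Suc q)" using step by simp
        moreover have "df_F X w \<tau> p \<le> df_F X w \<tau> q"
          using Suc q by (cases "p = q") auto
        ultimately show "df_F X w \<tau> p < df_F X w \<tau> (Suc q)" by simp
      qed
    qed simp
    then show "df_F X w \<tau> p < df_F X w \<tau> q" using pq by simp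
  qed
  show "df_F X w \<tau> (p + 1) - df_F X w \<tau> p =
      sq_norm_wrt (U_mat X w \<tau>) (next_residual X w p) / (euclid_norm (next_residual X w p))\<^sup>2"
    if "1 \<le> p \<and> p < d" for p
    using df_F_increment[where w = w, OF X_dim d_less_n w_pos inj] that by simp
qed

end
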